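(* Let $G$ be a topological group. Then $G$ is $PS\mathcal{M}$-factorizable if and only if $G$ is feathered and $S\mathcal{M}$-factorizable.
   Context: All topological spaces (in particular all topological groups) are assumed Hausdorff. A continuous map $f:X\to Y$ is perfect if it is closed, onto, and all fibers $f^{-1}(y)$ are compact; a perfect homomorphism is a continuous group homomorphism that is a perfect map. A topological group $G$ is feathered if it contains a non-empty compact set $K$ of countable character in $G$, i.e. there is a countable family of open sets containing $K$ such that every open set containing $K$ contains a member of the family. A topological group $G$ is $S\mathcal{M}$-factorizable (respectively, $PS\mathcal{M}$-factorizable) if for every continuous mapping $f:G\to M$ to a metrizable space $M$ there are a continuous (respectively, perfect) homomorphism $\pi:G\to H$ onto a metrizable topological group $H$ and a continuous mapping $g:H\to M$ such that $f=g\circ\pi$. *)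

theory Defs
  imports "HOL-Analysis.Analysis" "HOL-Algebra.Group"
begin

locale topological_group = group G for G :: "('a, 'b) monoid_scheme" (structure) +
  fixes T :: "'a topology"
  assumes topspace_eq_carrier: "topspace T = carrier G"
    and Hausdorff: "Hausdorff_space T"
    and continuous_mult: "continuous_map (prod_topology T T) T (\<lambda>(x, y). x \<otimes> y)"
    and continuous_inv: "continuous_map T T (\<lambda>x. inv x)"

definition countable_character_in :: "'a topology \<Rightarrow> 'a set \<Rightarrow> bool" where
  "countable_character_in T K \<longleftrightarrow>
    (\<exists>\<B>. countable \<B> \<and> (\<forall>V\<in>\<B>. openin T V \<and> K \<subseteq> V) \<and>
         (\<forall>U. openin T U \<and> K \<subseteq> U \<longrightarrow> (\<exists>V\<in>\<B>. V \<subseteq> U)))"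

definition feathered :: "'a topology \<Rightarrow> bool" where
  "feathered T \<longleftrightarrow> (\<exists>K. K \<noteq> {} \<and> compactin T K \<and> countable_character_in T K)"

definition continuous_hom_onto ::
    "('a, 'b) monoid_scheme \<Rightarrow> 'a topology \<Rightarrow> ('c, 'd) monoid_scheme \<Rightarrow> 'c topology
      \<Rightarrow> ('a \<Rightarrow> 'c) \<Rightarrow> bool" where
  "continuous_hom_onto G T H S \<pi> \<longleftrightarrow>
    \<pi> \<in> hom G H \<and> continuous_map T S \<pi> \<and> \<pi> ` carrier G = carrier H"

text \<open>Surjectivity and continuity are part of \<^const>\<open>perfect_map\<close>.\<close>

definition perfect_hom ::
    "('a, 'b) monoid_scheme \<Rightarrow> 'a topology \<Rightarrow> ('c, 'd) monoid_scheme \<Rightarrow> 'c topology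
      \<Rightarrow> ('a \<Rightarrow> 'c) \<Rightarrow> bool" where
  "perfect_hom G T H S \<pi> \<longleftrightarrow> \<pi> \<in> hom G H \<and> perfect_map T S \<pi>"

text \<open>
  A definition cannot quantify over types, so the metrizable spaces \<open>M\<close> and the metrizable
  groups \<open>H\<close> below have points in \<^typ>\<open>'a set\<close>, where \<^typ>\<open>'a\<close> is the type of the elements
  of \<open>G\<close>. This loses no generality: the image of a map on \<open>G\<close> is in bijection with the
  fibres of the map, which are subsets of \<open>G\<close>. The lemmas
  \<open>SM_factorizableD\<close>, \<open>SM_factorizableI\<close>, \<open>PSM_factorizableD\<close>, \<open>PSM_factorizableI\<close>
  prove that \<open>M\<close> and \<open>H\<close> may have points of any type.
\<close>

definition SM_factorizable :: "('a, 'b) monoid_scheme \<Rightarrow> 'a topology \<Rightarrow> bool" where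
  "SM_factorizable G T \<longleftrightarrow>
    (\<forall>(M :: 'a set topology) f. metrizable_space M \<and> continuous_map T M f \<longrightarrow>
      (\<exists>(H :: 'a set monoid) S \<pi> g.
        topological_group H S \<and> metrizable_space S \<and> continuous_hom_onto G T H S \<pi> \<and>
        continuous_map S M g \<and> (\<forall>x\<in>carrier G. f x = g (\<pi> x))))"

definition PSM_factorizable :: "('a, 'b) monoid_scheme \<Rightarrow> 'a topology \<Rightarrow> bool" where
  "PSM_factorizable G T \<longleftrightarrow>
    (\<forall>(M :: 'a set topology) f. metrizable_space M \<and> continuous_map T M f \<longrightarrow>
      (\<exists>(H :: 'a set monoid) S \<pi> g.
        topological_group H S \<and> metrizable_space S \<and> perfect_hom G T H S \<pi> \<and>
        continuous_map S M g \<and> (\<forall>x\<in>carrier G. f x = g (\<pi> x))))"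


subsection \<open>Independence of the choice of types\<close>

lemma transport_topology:
  fixes S :: "'c topology" and \<phi> :: "'c \<Rightarrow> 'd"
  assumes "inj_on \<phi> (topspace S)"
  obtains S' :: "'d topology" where
    "topspace S' = \<phi> ` topspace S"
    "homeomorphic_maps S S' \<phi> (inv_into (topspace S) \<phi>)"
proof -
  let ?\<psi> = "inv_into (topspace S) \<phi>"
  let ?A = "\<phi> ` topspace S"
  let ?S' = "pullback_topology ?A ?\<psi> S"
  have top: "topspace ?S' = ?A"
    using assms by (auto simp: topspace_pullback_topology)
  have "continuous_map S ?S' \<phi>"
  proof (rule continuous_map_pullback')
    show "continuous_map S S (?\<psi> \<circ> \<phi>)"
      using assms by (auto intro: continuous_map_eq[OF continuous_map_id])
  qed auto
  moreover have "continuous_map ?S' S ?\<psi>"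
    using continuous_map_pullback[OF continuous_map_id, of ?A ?\<psi> S] by simp
  ultimately have "homeomorphic_maps S ?S' \<phi> ?\<psi>"
    using assms top by (auto simp: homeomorphic_maps_def f_inv_into_f)
  then show thesis using that top by blast
qed

lemma transport_topological_group:
  fixes H :: "('c, 'e) monoid_scheme" and \<phi> :: "'c \<Rightarrow> 'd"
  assumes "topological_group H S" and inj: "inj_on \<phi> (carrier H)"
  obtains H' :: "'d monoid" and S' where
    "topological_group H' S'" "\<phi> \<in> iso H H'"
    "homeomorphic_maps S S' \<phi> (inv_into (carrier H) \<phi>)"
proof -
  interpret H: topological_group H S by fact
  let ?\<psi> = "inv_into (carrier H) \<phi>"
  define H' :: "'d monoid" where
    "H' = \<lparr>carrier = \<phi> ` carrier H, mult = (\<lambda>a b. \<phi> (?\<psi> a \<otimes>\<^bsub>H\<^esub> ?\<psi> b)), one = \<phi> \<one>\<^bsub>H\<^esub>\<rparr>"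
  obtain S' where top: "topspace S' = \<phi> ` carrier H"
    and hm: "homeomorphic_maps S S' \<phi> ?\<psi>"
    using transport_topology[of \<phi> S] inj unfolding H.topspace_eq_carrier by metis
  have [simp]: "?\<psi> (\<phi> h) = h" if "h \<in> carrier H" for h using that inj by simp
  have iso: "\<phi> \<in> iso H H'"
    using inj by (auto simp: iso_def hom_def H'_def bij_betw_def)
  have grp: "group H'"
  proof (rule groupI)
    fix x assume "x \<in> carrier H'"
    then obtain h where h: "h \<in> carrier H" "x = \<phi> h" by (auto simp: H'_def)
    show "\<exists>y\<in>carrier H'. y \<otimes>\<^bsub>H'\<^esub> x = \<one>\<^bsub>H'\<^esub>"
      by (rule bexI[of _ "\<phi> (inv\<^bsub>H\<^esub> h)"]) (use h in \<open>auto simp: H'_def\<close>)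
  qed (auto simp: H'_def H.m_assoc)
  have carrier': "carrier H' = \<phi> ` carrier H"
    and mult': "x \<otimes>\<^bsub>H'\<^esub> y = \<phi> (?\<psi> x \<otimes>\<^bsub>H\<^esub> ?\<psi> y)" for x y
    by (simp_all add: H'_def)
  have gh: "group_hom H H' \<phi>"
    using iso by (intro group_hom.intro group_hom_axioms.intro H.is_group grp) (simp add: iso_def)
  have hs: "S homeomorphic_space S'"
    unfolding homeomorphic_space_def by (intro exI) (rule hm)
  have c\<phi>: "continuous_map S S' \<phi>" and c\<psi>: "continuous_map S' S ?\<psi>"
    using hm by (auto simp: homeomorphic_maps_def)
  have "topological_group H' S'"
  proof (rule topological_group.intro[OF grp topological_group_axioms.intro])
    show "topspace S' = carrier H'" by (simp only: top carrier')
    show "Hausdorff_space S'"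
      using H.Hausdorff homeomorphic_Hausdorff_space[OF hs] by simp
    have "continuous_map (prod_topology S' S') S'
        (\<phi> \<circ> (\<lambda>(x, y). x \<otimes>\<^bsub>H\<^esub> y) \<circ> (\<lambda>(x, y). (?\<psi> x, ?\<psi> y)))"
    proof (intro continuous_map_compose)
      show "continuous_map (prod_topology S' S') (prod_topology S S) (\<lambda>(x, y). (?\<psi> x, ?\<psi> y))"
        using c\<psi> unfolding continuous_map_prod_top by blast
    qed (fact H.continuous_mult c\<phi>)+
    then show "continuous_map (prod_topology S' S') S' (\<lambda>(x, y). x \<otimes>\<^bsub>H'\<^esub> y)"
      by (rule continuous_map_eq) (auto simp: mult')
    have "continuous_map S' S' (\<phi> \<circ> (\<lambda>x. inv\<^bsub>H\<^esub> x) \<circ> ?\<psi>)"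
      using c\<psi> continuous_map_compose[OF H.continuous_inv c\<phi>] by (rule continuous_map_compose)
    then show "continuous_map S' S' (\<lambda>x. inv\<^bsub>H'\<^esub> x)"
    proof (rule continuous_map_eq)
      fix x assume "x \<in> topspace S'"
      then obtain h where "h \<in> carrier H" "x = \<phi> h" by (auto simp: top)
      then show "(\<phi> \<circ> (\<lambda>x. inv\<^bsub>H\<^esub> x) \<circ> ?\<psi>) x = inv\<^bsub>H'\<^esub> x"
        by (simp add: group_hom.hom_inv[OF gh])
    qed
  qed
  then show thesis using that iso hm by blast
qed

lemma transport_factorization:
  fixes G :: "('a, 'b) monoid_scheme" and H :: "('c, 'd) monoid_scheme"
  assumes "topspace T = carrier G"
    and H: "topological_group H S" "metrizable_space S" "continuous_hom_onto G T H S \<pi>"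
    and g: "continuous_map S M g" "\<forall>x\<in>carrier G. f x = g (\<pi> x)"
  shows "\<exists>(H' :: 'a set monoid) S' \<pi>' g'.
      topological_group H' S' \<and> metrizable_space S' \<and> continuous_hom_onto G T H' S' \<pi>' \<and>
      (perfect_hom G T H S \<pi> \<longrightarrow> perfect_hom G T H' S' \<pi>') \<and>
      continuous_map S' M g' \<and> (\<forall>x\<in>carrier G. f x = g' (\<pi>' x))"
proof -
  define \<phi> where "\<phi> h = {x \<in> carrier G. \<pi> x = h}" for h
  have \<pi>: "\<pi> \<in> hom G H" "continuous_map T S \<pi>" "\<pi> ` carrier G = carrier H"
    using H(3) by (auto simp: continuous_hom_onto_def)
  have inj: "inj_on \<phi> (carrier H)"
    unfolding inj_on_def \<phi>_def \<pi>(3)[symmetric] by blast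
  obtain H' :: "'a set monoid" and S' where H': "topological_group H' S'"
    and iso: "\<phi> \<in> iso H H'" and hm: "homeomorphic_maps S S' \<phi> (inv_into (carrier H) \<phi>)"
    using transport_topological_group[OF H(1) inj] by metis
  have hs: "S homeomorphic_space S'"
    unfolding homeomorphic_space_def by (intro exI) (rule hm)
  have c: "continuous_map S S' \<phi>" "continuous_map S' S (inv_into (carrier H) \<phi>)"
    using hm by (auto simp: homeomorphic_maps_def)
  have hom: "\<phi> \<circ> \<pi> \<in> hom G H'"
    using iso \<pi>(1) by (auto simp: iso_def intro: hom_compose)
  have onto: "(\<phi> \<circ> \<pi>) ` carrier G = carrier H'"
    using iso unfolding image_comp[symmetric] \<pi>(3) by (simp add: iso_def bij_betw_def)
  have cont: "continuous_map T S' (\<phi> \<circ> \<pi>)"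
    using \<pi>(2) c(1) by (rule continuous_map_compose)
  have "continuous_hom_onto G T H' S' (\<phi> \<circ> \<pi>)"
    using hom onto cont by (simp only: continuous_hom_onto_def)
  moreover have "metrizable_space S'"
    using H(2) homeomorphic_metrizable_space[OF hs] by simp
  moreover have "perfect_hom G T H' S' (\<phi> \<circ> \<pi>)" if "perfect_hom G T H S \<pi>"
  proof -
    have "proper_map S S' \<phi>"
      by (rule homeomorphic_imp_proper_map) (use hm in \<open>auto simp: homeomorphic_maps_map\<close>)
    moreover have "proper_map T S \<pi>"
      using that by (simp only: perfect_hom_def perfect_map_def)
    ultimately have "proper_map T S' (\<phi> \<circ> \<pi>)"
      using proper_map_compose by blast
    then show ?thesis
      using hom onto cont unfolding perfect_hom_def perfect_map_def assms(1)
        topological_group.topspace_eq_carrier[OF H'] by (intro conjI)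
  qed
  moreover have "continuous_map S' M (g \<circ> inv_into (carrier H) \<phi>)"
    using c(2) g(1) by (rule continuous_map_compose)
  moreover have "\<forall>x\<in>carrier G. f x = (g \<circ> inv_into (carrier H) \<phi>) ((\<phi> \<circ> \<pi>) x)"
  proof
    fix x assume "x \<in> carrier G"
    moreover from this have "\<pi> x \<in> carrier H" using \<pi>(3) by blast
    ultimately show "f x = (g \<circ> inv_into (carrier H) \<phi>) ((\<phi> \<circ> \<pi>) x)"
      using g(2) inj by simp
  qed
  ultimately show ?thesis using H' by (intro exI conjI impI)
qed

lemma transport_target:
  fixes T :: "'a topology" and M :: "'m topology"
  assumes M: "metrizable_space M" and f: "continuous_map T M f"
  obtains M' :: "'a set topology" and f' \<psi> where
    "metrizable_space M'" "continuous_map T M' f'" "continuous_map M' M \<psi>"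
    "\<And>x. x \<in> topspace T \<Longrightarrow> \<psi> (f' x) = f x"
proof -
  define M0 where "M0 = subtopology M (f ` topspace T)"
  define \<phi> where "\<phi> y = {x \<in> topspace T. f x = y}" for y
  have top: "topspace M0 = f ` topspace T"
    using f by (auto simp: M0_def continuous_map_def)
  have inj: "inj_on \<phi> (topspace M0)"
    unfolding inj_on_def \<phi>_def top by blast
  obtain M' where hm: "homeomorphic_maps M0 M' \<phi> (inv_into (topspace M0) \<phi>)"
    using transport_topology[OF inj] by metis
  have hs: "M0 homeomorphic_space M'"
    unfolding homeomorphic_space_def by (intro exI) (rule hm)
  show thesis
  proof
    have "metrizable_space M0"
      unfolding M0_def by (rule metrizable_space_subtopology[OF M])
    then show "metrizable_space M'"
      using homeomorphic_metrizable_space[OF hs] by simp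
    have "continuous_map T M0 f"
      using f by (simp add: M0_def continuous_map_in_subtopology)
    then show "continuous_map T M' (\<phi> \<circ> f)"
      using hm by (auto simp: homeomorphic_maps_def intro: continuous_map_compose)
    show "continuous_map M' M (inv_into (topspace M0) \<phi>)"
      using hm by (simp add: homeomorphic_maps_def M0_def continuous_map_in_subtopology)
    show "inv_into (topspace M0) \<phi> ((\<phi> \<circ> f) x) = f x" if "x \<in> topspace T" for x
      using that inj top by simp
  qed
qed

lemma SM_factorizableD:
  fixes G :: "('a, 'b) monoid_scheme" and M :: "'m topology"
  assumes "SM_factorizable G T" and T: "topspace T = carrier G"
    and M: "metrizable_space M" "continuous_map T M f"
  shows "\<exists>(H :: 'a set monoid) S \<pi> g.
      topological_group H S \<and> metrizable_space S \<and> continuous_hom_onto G T H S \<pi> \<and>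
      continuous_map S M g \<and> (\<forall>x\<in>carrier G. f x = g (\<pi> x))"
proof -
  obtain M' :: "'a set topology" and f' \<psi> where M': "metrizable_space M'" "continuous_map T M' f'"
    and \<psi>: "continuous_map M' M \<psi>" "\<And>x. x \<in> topspace T \<Longrightarrow> \<psi> (f' x) = f x"
    using transport_target[OF M] by metis
  obtain H :: "'a set monoid" and S \<pi> g where
    *: "topological_group H S" "metrizable_space S" "continuous_hom_onto G T H S \<pi>"
       "continuous_map S M' g" "\<forall>x\<in>carrier G. f' x = g (\<pi> x)"
    using assms(1)[unfolded SM_factorizable_def, rule_format, OF conjI[OF M']]
    by (elim exE conjE) (rule that; assumption)
  have "continuous_map S M (\<psi> \<circ> g)"
    using *(4) \<psi>(1) by (rule continuous_map_compose)
  moreover have "\<forall>x\<in>carrier G. f x = (\<psi> \<circ> g) (\<pi> x)"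
    using *(5) \<psi>(2) T by force
  ultimately show ?thesis
    using *(1-3) by (intro exI conjI)
qed

lemma PSM_factorizableD:
  fixes G :: "('a, 'b) monoid_scheme" and M :: "'m topology"
  assumes "PSM_factorizable G T" and T: "topspace T = carrier G"
    and M: "metrizable_space M" "continuous_map T M f"
  shows "\<exists>(H :: 'a set monoid) S \<pi> g.
      topological_group H S \<and> metrizable_space S \<and> perfect_hom G T H S \<pi> \<and>
      continuous_map S M g \<and> (\<forall>x\<in>carrier G. f x = g (\<pi> x))"
proof -
  obtain M' :: "'a set topology" and f' \<psi> where M': "metrizable_space M'" "continuous_map T M' f'"
    and \<psi>: "continuous_map M' M \<psi>" "\<And>x. x \<in> topspace T \<Longrightarrow> \<psi> (f' x) = f x"
    using transport_target[OF M] by metis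
  obtain H :: "'a set monoid" and S \<pi> g where
    *: "topological_group H S" "metrizable_space S" "perfect_hom G T H S \<pi>"
       "continuous_map S M' g" "\<forall>x\<in>carrier G. f' x = g (\<pi> x)"
    using assms(1)[unfolded PSM_factorizable_def, rule_format, OF conjI[OF M']]
    by (elim exE conjE) (rule that; assumption)
  have "continuous_map S M (\<psi> \<circ> g)"
    using *(4) \<psi>(1) by (rule continuous_map_compose)
  moreover have "\<forall>x\<in>carrier G. f x = (\<psi> \<circ> g) (\<pi> x)"
    using *(5) \<psi>(2) T by force
  ultimately show ?thesis
    using *(1-3) by (intro exI conjI)
qed

lemma SM_factorizableI:
  fixes G :: "('a, 'b) monoid_scheme"
  assumes T: "topspace T = carrier G"
    and "\<And>(M :: 'a set topology) f. metrizable_space M \<Longrightarrow> continuous_map T M f \<Longrightarrow>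
      \<exists>(H :: 'h monoid) S \<pi> g.
        topological_group H S \<and> metrizable_space S \<and> continuous_hom_onto G T H S \<pi> \<and>
        continuous_map S M g \<and> (\<forall>x\<in>carrier G. f x = g (\<pi> x))"
  shows "SM_factorizable G T"
  unfolding SM_factorizable_def
proof (intro allI impI, elim conjE)
  fix M :: "'a set topology" and f
  assume M: "metrizable_space M" "continuous_map T M f"
  obtain H :: "'h monoid" and S \<pi> g where
    *: "topological_group H S" "metrizable_space S" "continuous_hom_onto G T H S \<pi>"
       "continuous_map S M g" "\<forall>x\<in>carrier G. f x = g (\<pi> x)"
    using assms(2)[OF M] by (elim exE conjE) (rule that; assumption)
  show "\<exists>(H :: 'a set monoid) S \<pi> g.
        topological_group H S \<and> metrizable_space S \<and> continuous_hom_onto G T H S \<pi> \<and>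
        continuous_map S M g \<and> (\<forall>x\<in>carrier G. f x = g (\<pi> x))"
    using transport_factorization[OF T *]
    by (elim exE conjE) (intro exI conjI; assumption)
qed

lemma PSM_factorizableI:
  fixes G :: "('a, 'b) monoid_scheme"
  assumes T: "topspace T = carrier G"
    and "\<And>(M :: 'a set topology) f. metrizable_space M \<Longrightarrow> continuous_map T M f \<Longrightarrow>
      \<exists>(H :: 'h monoid) S \<pi> g.
        topological_group H S \<and> metrizable_space S \<and> perfect_hom G T H S \<pi> \<and>
        continuous_map S M g \<and> (\<forall>x\<in>carrier G. f x = g (\<pi> x))"
  shows "PSM_factorizable G T"
  unfolding PSM_factorizable_def
proof (intro allI impI, elim conjE)
  fix M :: "'a set topology" and f
  assume M: "metrizable_space M" "continuous_map T M f"
  obtain H :: "'h monoid" and S \<pi> g where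
    *: "topological_group H S" "metrizable_space S" "perfect_hom G T H S \<pi>"
       "continuous_map S M g" "\<forall>x\<in>carrier G. f x = g (\<pi> x)"
    using assms(2)[OF M] by (elim exE conjE) (rule that; assumption)
  have onto: "continuous_hom_onto G T H S \<pi>"
    using *(1,3) T by (simp add: perfect_hom_def perfect_map_def continuous_hom_onto_def
        topological_group.topspace_eq_carrier)
  show "\<exists>(H :: 'a set monoid) S \<pi> g.
        topological_group H S \<and> metrizable_space S \<and> perfect_hom G T H S \<pi> \<and>
        continuous_map S M g \<and> (\<forall>x\<in>carrier G. f x = g (\<pi> x))"
    using transport_factorization[OF T *(1,2) onto *(4,5)]
    by - (elim exE conjE, drule mp[OF _ *(3)], intro exI conjI)
qed

end

theory Submission
  imports Defs
begin

text \<open>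
  Suppose \<open>G\<close> is feathered. Inside a compact set of countable character one finds a compact
  subgroup \<open>N\<close> whose neighbourhoods have a base \<open>V\<^sub>0 \<supseteq> V\<^sub>1 \<supseteq> \<dots>\<close> with \<open>V\<^sub>n\<^sub>+\<^sub>1\<^sup>3 \<subseteq> V\<^sub>n\<close>, and the
  Birkhoff--Kakutani construction yields a left-invariant pseudometric whose balls around the
  unit are comparable to the \<open>V\<^sub>n\<close>. Its metric identification \<open>p\<close> is a proper map from \<open>G\<close> to a
  metrizable space, with the left cosets of \<open>N\<close> as fibres. Given \<open>f\<close>, factorize the pair
  \<open>(f, p)\<close> through a homomorphism \<open>\<pi>\<close>: as \<open>p\<close> is proper and factors through \<open>\<pi>\<close>, so is \<open>\<pi>\<close>.
  Conversely, the kernel of a perfect homomorphism onto a metrizable group is a compact set of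
  countable character.
\<close>

section \<open>Cutting weighted lists and multiplying lists of group elements\<close>

text \<open>Heads are peeled off until the remaining target no longer exceeds the next weight, which
  locates the entry \<open>p\<close> where the partial sums cross \<open>t\<close>. Taken with
  \<open>t\<close> half of the total, this cuts a word into two light outer pieces and one middle
  letter.\<close>

lemma sum_list_split:
  fixes w :: "'a \<Rightarrow> real"
  assumes "ps \<noteq> []" "0 \<le> t" "t \<le> sum_list (map w ps)"
  shows "\<exists>as p bs. ps = as @ p # bs \<and> sum_list (map w as) \<le> t \<and> t \<le> sum_list (map w as) + w p"
  using assms
proof (induction ps arbitrary: t)
  case Nil
  then show ?case by simp
next
  case (Cons a ps)
  show ?case
  proof (cases "t \<le> w a \<or> ps = []")
    case True
    then show ?thesis
      using Cons.prems by (intro exI[of _ "[]"] exI[of _ a] exI[of _ ps]) auto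
  next
    case False
    then obtain as p bs where "ps = as @ p # bs" "sum_list (map w as) \<le> t - w a"
      "t - w a \<le> sum_list (map w as) + w p"
      using Cons.IH[of "t - w a"] Cons.prems by auto
    then show ?thesis
      by (intro exI[of _ "a # as"] exI[of _ p] exI[of _ bs]) auto
  qed
qed

lemma (in monoid) foldr_mult_append:
  assumes "set xs \<subseteq> carrier G" "set ys \<subseteq> carrier G"
  shows "foldr (\<otimes>) (xs @ ys) \<one> = foldr (\<otimes>) xs \<one> \<otimes> foldr (\<otimes>) ys \<one>"
proof -
  have closed: "foldr (\<otimes>) zs \<one> \<in> carrier G" if "set zs \<subseteq> carrier G" for zs
    using that by (induction zs) auto
  show ?thesis
    using assms(1) by (induction xs) (use assms(2) closed in \<open>auto simp: m_assoc\<close>)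
qed

lemma (in group) foldr_mult_inv:
  assumes "set xs \<subseteq> carrier G"
  shows "foldr (\<otimes>) xs \<one> \<in> carrier G"
    and "inv (foldr (\<otimes>) xs \<one>) = foldr (\<otimes>) (rev (map (\<lambda>x. inv x) xs)) \<one>"
proof -
  show closed: "foldr (\<otimes>) xs \<one> \<in> carrier G"
    using assms by (induction xs) auto
  show "inv (foldr (\<otimes>) xs \<one>) = foldr (\<otimes>) (rev (map (\<lambda>x. inv x) xs)) \<one>"
    using assms
  proof (induction xs)
    case (Cons a xs)
    have "foldr (\<otimes>) xs \<one> \<in> carrier G"
      using Cons.prems by (induction xs) auto
    moreover have "foldr (\<otimes>) (rev (map (\<lambda>x. inv x) xs) @ [inv a]) \<one> =
        foldr (\<otimes>) (rev (map (\<lambda>x. inv x) xs)) \<one> \<otimes> foldr (\<otimes>) [inv a] \<one>"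
      by (rule foldr_mult_append) (use Cons.prems in auto)
    ultimately show ?case
      using Cons by (simp add: inv_mult_group)
  qed simp
qed

lemma (in group) mult_inv_cancel_left:
  assumes "a \<in> carrier G" "x \<in> carrier G"
  shows "a \<otimes> (inv a \<otimes> x) = x" "inv a \<otimes> (a \<otimes> x) = x"
  using assms by (simp_all add: m_assoc[symmetric])

section \<open>Translations and neighbourhoods of the unit\<close>

context topological_group
begin

lemma continuous_map_translation:
  assumes "a \<in> carrier G"
  shows "continuous_map T T (\<lambda>x. a \<otimes> x)"
proof -
  have "continuous_map T (prod_topology T T) (\<lambda>x. (a, x))"
    by (intro continuous_intros continuous_map_id[unfolded id_def])
      (simp add: assms topspace_eq_carrier)
  from continuous_map_compose[OF this continuous_mult] show ?thesis
    by (simp add: o_def)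
qed

lemma openin_translation:
  assumes "a \<in> carrier G" "openin T U"
  shows "openin T {x \<in> carrier G. a \<otimes> x \<in> U}"
  using openin_continuous_map_preimage[OF continuous_map_translation[OF assms(1)] assms(2)]
  by (simp add: topspace_eq_carrier)

lemma mult_nbhds:
  assumes "openin T W" "a \<in> carrier G" "b \<in> carrier G" "a \<otimes> b \<in> W"
  obtains U V where "openin T U" "openin T V" "a \<in> U" "b \<in> V"
    "\<And>x y. x \<in> U \<Longrightarrow> y \<in> V \<Longrightarrow> x \<otimes> y \<in> W"
proof -
  have "openin (prod_topology T T)
      {z \<in> topspace (prod_topology T T). (\<lambda>(x, y). x \<otimes> y) z \<in> W}" (is "openin _ ?P")
    by (rule openin_continuous_map_preimage[OF continuous_mult assms(1)])
  moreover have "(a, b) \<in> ?P"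
    using assms by (simp add: topspace_eq_carrier)
  ultimately obtain U V where "openin T U" "openin T V" "a \<in> U" "b \<in> V" "U \<times> V \<subseteq> ?P"
    unfolding openin_prod_topology_alt by meson
  then show thesis by (intro that[of U V]) auto
qed

text \<open>Continuity of multiplication at the unit is used twice: \<open>C\<close> and
  \<open>D\<close> multiply into \<open>A\<close>, and \<open>A\<close> and \<open>B\<close>
  multiply into \<open>W\<close>. Intersecting \<open>B\<close>, \<open>C\<close>, \<open>D\<close>
  controls triple products; intersecting the result with its preimage under inversion makes it
  symmetric.\<close>

lemma symmetric_cube_nbhd:
  assumes "openin T W" "\<one> \<in> W"
  shows "\<exists>V. openin T V \<and> \<one> \<in> V \<and> (\<forall>x\<in>V. inv x \<in> V) \<and>
    (\<forall>x\<in>V. \<forall>y\<in>V. \<forall>z\<in>V. x \<otimes> y \<otimes> z \<in> W)"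
proof -
  obtain A B where A: "openin T A" "openin T B" "\<one> \<in> A" "\<one> \<in> B"
    "\<And>x y. x \<in> A \<Longrightarrow> y \<in> B \<Longrightarrow> x \<otimes> y \<in> W"
    using mult_nbhds[OF assms(1), of \<one> \<one>] assms(2) by auto
  obtain C D where C: "openin T C" "openin T D" "\<one> \<in> C" "\<one> \<in> D"
    "\<And>x y. x \<in> C \<Longrightarrow> y \<in> D \<Longrightarrow> x \<otimes> y \<in> A"
    using mult_nbhds[OF A(1), of \<one> \<one>] A(3) by auto
  define E where "E = B \<inter> C \<inter> D"
  have E: "openin T E" "\<one> \<in> E" "E \<subseteq> carrier G"
    using A C openin_subset[of T B] by (auto simp: E_def topspace_eq_carrier)
  have "openin T {x \<in> topspace T. inv x \<in> E}"
    by (rule openin_continuous_map_preimage[OF continuous_inv E(1)])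
  then have "openin T (E \<inter> {x \<in> topspace T. inv x \<in> E})"
    using E(1) by blast
  then show ?thesis
    using E A(5) C(5)
    by (intro exI[of _ "E \<inter> {x \<in> topspace T. inv x \<in> E}"])
      (auto simp: topspace_eq_carrier E_def)
qed

text \<open>Left translation by \<open>a\<close> is a homeomorphism whose inverse is translation by
  \<open>inv a\<close>, so it carries neighbourhood bases along. This serves to move a compact set
  of countable character onto the unit.\<close>

lemma countable_character_translate:
  assumes "a \<in> carrier G" "compactin T K" "countable_character_in T K"
  shows "compactin T ((\<lambda>x. a \<otimes> x) ` K)"
    and "countable_character_in T ((\<lambda>x. a \<otimes> x) ` K)"
proof -
  show "compactin T ((\<lambda>x. a \<otimes> x) ` K)"
    by (rule image_compactin[OF assms(2) continuous_map_translation[OF assms(1)]])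
  obtain \<B> where \<B>: "countable \<B>" "\<And>V. V \<in> \<B> \<Longrightarrow> openin T V \<and> K \<subseteq> V"
    "\<And>U. openin T U \<Longrightarrow> K \<subseteq> U \<Longrightarrow> \<exists>V\<in>\<B>. V \<subseteq> U"
    using assms(3) unfolding countable_character_in_def by metis
  have K: "K \<subseteq> carrier G"
    using compactin_subset_topspace[OF assms(2)] by (simp add: topspace_eq_carrier)
  define tr where "tr V = {x \<in> carrier G. inv a \<otimes> x \<in> V}" for V
  have "openin T (tr V) \<and> (\<lambda>x. a \<otimes> x) ` K \<subseteq> tr V" if "V \<in> \<B>" for V
    using \<B>(2)[OF that] K assms(1) mult_inv_cancel_left(2)[OF assms(1)]
    by (fastforce simp: tr_def openin_translation)
  moreover have "\<exists>V\<in>\<B>. tr V \<subseteq> U" if U: "openin T U" "(\<lambda>x. a \<otimes> x) ` K \<subseteq> U" for U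
  proof -
    have "K \<subseteq> {x \<in> carrier G. a \<otimes> x \<in> U}"
      using U(2) K by auto
    then obtain V where V: "V \<in> \<B>" "V \<subseteq> {x \<in> carrier G. a \<otimes> x \<in> U}"
      using \<B>(3) openin_translation[OF assms(1) U(1)] by meson
    have "tr V \<subseteq> U"
    proof
      fix x assume "x \<in> tr V"
      then have "x \<in> carrier G" "a \<otimes> (inv a \<otimes> x) \<in> U"
        using V(2) by (auto simp: tr_def)
      then show "x \<in> U"
        using mult_inv_cancel_left(1)[OF assms(1)] by simp
    qed
    then show ?thesis using V(1) by blast
  qed
  ultimately show "countable_character_in T ((\<lambda>x. a \<otimes> x) ` K)"
    unfolding countable_character_in_def using \<B>(1) by (intro exI[of _ "tr ` \<B>"]) auto
qed

end


section \<open>The Birkhoff--Kakutani gauge of a chain of neighbourhoods\<close>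

text \<open>Cubes rather than squares are required because words will be cut into three pieces.
  Starting at the whole group makes every element a one-letter word, so that \<open>gauge\<close> is
  an infimum over a nonempty set.\<close>

locale nbhd_chain = topological_group +
  fixes V :: "nat \<Rightarrow> 'a set"
  assumes V_0: "V 0 = carrier G"
    and V_open: "openin T (V n)"
    and V_one: "\<one> \<in> V n"
    and V_inv: "x \<in> V n \<Longrightarrow> inv x \<in> V n"
    and V_cube: "x \<in> V (Suc n) \<Longrightarrow> y \<in> V (Suc n) \<Longrightarrow> z \<in> V (Suc n) \<Longrightarrow> x \<otimes> y \<otimes> z \<in> V n"
begin

lemma V_carrier: "V n \<subseteq> carrier G"
  using openin_subset[OF V_open] by (simp add: topspace_eq_carrier)

lemma V_mono: "m \<le> n \<Longrightarrow> V n \<subseteq> V m"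
proof (rule lift_Suc_antimono_le[of V])
  show "V (Suc n) \<subseteq> V n" for n
    using V_cube[OF _ V_one V_one] V_carrier by fastforce
qed

lemma V_square: "x \<in> V (Suc n) \<Longrightarrow> y \<in> V (Suc n) \<Longrightarrow> x \<otimes> y \<in> V n"
  using V_cube[OF _ _ V_one, of x n y] V_carrier[of "Suc n"] by (simp add: subset_iff)

text \<open>\<open>W\<close> is the coset of \<open>V (Suc n)\<close> at \<open>x\<close>. A common
  point \<open>y\<close> would give \<open>x = y \<otimes> inv (inv x \<otimes> y)\<close>, a
  product of two elements of \<open>V (Suc n)\<close>, hence an element of \<open>V n\<close>. In
  other words, the closure of \<open>V (Suc n)\<close> lies in \<open>V n\<close>.\<close>

lemma V_separates:
  assumes "x \<in> carrier G" "x \<notin> V n"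
  obtains W where "openin T W" "x \<in> W" "W \<inter> V (Suc n) = {}"
proof
  let ?W = "{y \<in> carrier G. inv x \<otimes> y \<in> V (Suc n)}"
  show "openin T ?W"
    using assms by (intro openin_translation V_open) auto
  show "x \<in> ?W"
    using assms V_one by auto
  have False if "y \<in> carrier G" "inv x \<otimes> y \<in> V (Suc n)" "y \<in> V (Suc n)" for y
  proof -
    have "x = y \<otimes> inv (inv x \<otimes> y)"
      using assms that by (simp add: inv_mult_group m_assoc[symmetric])
    then show False
      using V_square[OF that(3) V_inv[OF that(2)]] assms(2) by simp
  qed
  then show "?W \<inter> V (Suc n) = {}" by blast
qed

lemma closedin_Inter_V: "closedin T (\<Inter>n. V n)"
  unfolding closedin_def
proof
  show "(\<Inter>n. V n) \<subseteq> topspace T"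
    using V_carrier by (auto simp: topspace_eq_carrier)
  show "openin T (topspace T - (\<Inter>n. V n))"
  proof (subst openin_subopen, intro ballI)
    fix x assume "x \<in> topspace T - (\<Inter>n. V n)"
    then obtain n W where "openin T W" "x \<in> W" "W \<inter> V (Suc n) = {}"
      using V_separates topspace_eq_carrier by (metis DiffE INT_I)
    then show "\<exists>W. openin T W \<and> x \<in> W \<and> W \<subseteq> topspace T - (\<Inter>n. V n)"
      using openin_subset[of T W] by (intro exI[of _ W]) auto
  qed
qed

text \<open>Words are lists of pairs \<open>(n, x)\<close> with \<open>x \<in> V\<^sub>n\<close>, such a letter having weight \<open>2\<^sup>-\<^sup>n\<close>.\<close>

definition good :: "(nat \<times> 'a) list \<Rightarrow> bool" where
  "good ps \<longleftrightarrow> (\<forall>(n, x)\<in>set ps. x \<in> V n)"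

definition word :: "(nat \<times> 'a) list \<Rightarrow> 'a" where
  "word ps = foldr (\<otimes>) (map snd ps) \<one>"

definition weight :: "(nat \<times> 'a) list \<Rightarrow> real" where
  "weight ps = sum_list (map (\<lambda>p. (1/2) ^ fst p) ps)"

text \<open>The infimum over words, rather than over single letters, is what makes the triangle
  inequality hold.\<close>

definition gauge :: "'a \<Rightarrow> real" where
  "gauge x = Inf {weight ps |ps. good ps \<and> word ps = x}"

lemma weight_append: "weight (ps @ qs) = weight ps + weight qs"
  by (simp add: weight_def)

lemma weight_Cons: "weight (p # ps) = (1/2) ^ fst p + weight ps"
  by (simp add: weight_def)

lemma weight_nonneg: "0 \<le> weight ps"
  unfolding weight_def by (rule sum_list_nonneg) auto

lemma good_carrier: "good ps \<Longrightarrow> set (map snd ps) \<subseteq> carrier G"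
  using V_carrier by (fastforce simp: good_def)

lemma word_closed: "good ps \<Longrightarrow> word ps \<in> carrier G"
  unfolding word_def by (intro foldr_mult_inv good_carrier)

lemma word_append: "good ps \<Longrightarrow> good qs \<Longrightarrow> word (ps @ qs) = word ps \<otimes> word qs"
  using foldr_mult_append[OF good_carrier good_carrier] by (simp add: word_def)

text \<open>Induction on the length. Cut the word at the letter where the partial weights cross half
  of the total: each outer piece weighs at most half, hence less than \<open>(1/2) ^ Suc m\<close>,
  and lies in \<open>V (Suc m)\<close> by induction. The middle letter weighs less than
  \<open>(1/2) ^ m\<close>, so its index is at least \<open>Suc m\<close>. The cube condition puts
  the product into \<open>V m\<close>.\<close>

lemma word_in_V:
  assumes "good ps" "weight ps < (1/2) ^ m"
  shows "word ps \<in> V m"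
  using assms
proof (induction ps arbitrary: m rule: length_induct)
  case (1 ps)
  show ?case
  proof (cases "ps = []")
    case True
    then show ?thesis using V_one by (simp add: word_def)
  next
    case False
    moreover have "0 \<le> weight ps / 2" "weight ps / 2 \<le> weight ps"
      using weight_nonneg[of ps] by simp_all
    ultimately obtain as p bs where ps: "ps = as @ p # bs"
      and as: "weight as \<le> weight ps / 2" "weight ps / 2 \<le> weight as + (1/2) ^ fst p"
      using sum_list_split[of ps "weight ps / 2" "\<lambda>p. (1/2) ^ fst p"]
      unfolding weight_def by metis
    have good: "good as" "good bs" "good [p]"
      using 1(2) by (auto simp: good_def ps)
    have w: "weight ps = weight as + (1/2) ^ fst p + weight bs"
      by (simp add: ps weight_append weight_Cons)
    have "word as \<in> V (Suc m)" "word bs \<in> V (Suc m)"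
      using 1(1)[rule_format, of as "Suc m"] 1(1)[rule_format, of bs "Suc m"] good as w 1(3)
      by (auto simp: ps)
    moreover have "snd p \<in> V (Suc m)"
    proof -
      have "(1/2::real) ^ fst p < (1/2) ^ m"
        using 1(3) w weight_nonneg[of as] weight_nonneg[of bs] by linarith
      then have "Suc m \<le> fst p"
        by (subst (asm) power_strict_decreasing_iff) auto
      then show ?thesis
        using good(3) V_mono[of "Suc m" "fst p"] by (auto simp: good_def)
    qed
    moreover have "word ps = word as \<otimes> snd p \<otimes> word bs"
    proof -
      have "word ps = word as \<otimes> (word [p] \<otimes> word bs)"
        using word_append[of as "p # bs"] word_append[of "[p]" bs] good 1(2)
        by (simp add: ps good_def)
      then show ?thesis
        using word_closed[OF good(1)] word_closed[OF good(2)] good_carrier[OF good(3)]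
        by (simp add: word_def[of "[p]"] m_assoc)
    qed
    ultimately show ?thesis using V_cube by simp
  qed
qed

lemma gauge_le: "good ps \<Longrightarrow> gauge (word ps) \<le> weight ps"
  unfolding gauge_def by (rule cInf_lower) (auto intro!: bdd_belowI[of _ 0] weight_nonneg)

lemma gauge_witness:
  assumes "x \<in> carrier G" "gauge x < r"
  obtains ps where "good ps" "word ps = x" "weight ps < r"
proof -
  have "good [(0, x)]" "word [(0, x)] = x"
    using assms(1) by (auto simp: good_def word_def V_0)
  then have "{weight ps |ps. good ps \<and> word ps = x} \<noteq> {}"
    by blast
  then obtain w where "w \<in> {weight ps |ps. good ps \<and> word ps = x}" "w < r"
    using assms(2) unfolding gauge_def by (meson cInf_lessD)
  then show thesis using that by blast
qed

lemma gauge_nonneg: "x \<in> carrier G \<Longrightarrow> 0 \<le> gauge x"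
  using weight_nonneg by (auto intro!: leI elim!: gauge_witness simp: not_less[symmetric])

text \<open>This is where \<open>word_in_V\<close> pays off. Together with
  \<open>gauge_le_in_V\<close> it traps \<open>V n\<close> between the open and the closed gauge
  ball of radius \<open>(1/2) ^ n\<close>.\<close>

lemma gauge_less_imp_in_V: "x \<in> carrier G \<Longrightarrow> gauge x < (1/2) ^ n \<Longrightarrow> x \<in> V n"
  by (erule gauge_witness) (auto dest: word_in_V)

lemma gauge_le_in_V: "x \<in> V n \<Longrightarrow> gauge x \<le> (1/2) ^ n"
  using gauge_le[of "[(n, x)]"] V_carrier[of n] by (auto simp: good_def word_def weight_def)

text \<open>Concatenating nearly optimal words for \<open>x\<close> and \<open>y\<close> gives a
  word for the product whose weight is the sum.\<close>

lemma gauge_mult: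
  assumes "x \<in> carrier G" "y \<in> carrier G"
  shows "gauge (x \<otimes> y) \<le> gauge x + gauge y"
proof (rule field_le_epsilon)
  fix e :: real assume "0 < e"
  obtain ps where ps: "good ps" "word ps = x" "weight ps < gauge x + e / 2"
    using gauge_witness[OF assms(1), of "gauge x + e / 2"] \<open>0 < e\<close> by auto
  obtain qs where qs: "good qs" "word qs = y" "weight qs < gauge y + e / 2"
    using gauge_witness[OF assms(2), of "gauge y + e / 2"] \<open>0 < e\<close> by auto
  have "good (ps @ qs)"
    using ps qs by (auto simp: good_def)
  then show "gauge (x \<otimes> y) \<le> gauge x + gauge y + e"
    using gauge_le[of "ps @ qs"] word_append[of ps qs] weight_append[of ps qs] ps qs by simp
qed

text \<open>Reversing a word and inverting its letters yields a word for \<open>inv x\<close> of the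
  same weight; the letters stay admissible because each \<open>V n\<close> is symmetric.\<close>

lemma gauge_inv_le:
  assumes "x \<in> carrier G"
  shows "gauge (inv x) \<le> gauge x"
proof (rule field_le_epsilon)
  fix e :: real assume "0 < e"
  obtain ps where ps: "good ps" "word ps = x" "weight ps < gauge x + e"
    using gauge_witness[OF assms, of "gauge x + e"] \<open>0 < e\<close> by auto
  let ?qs = "rev (map (map_prod id (\<lambda>x. inv x)) ps)"
  have "good ?qs"
    using ps V_inv by (fastforce simp: good_def)
  moreover have "word ?qs = inv x"
    using foldr_mult_inv(2)[OF good_carrier[OF ps(1)]] ps(2)
    by (simp add: word_def rev_map o_def)
  moreover have "weight ?qs = weight ps"
    by (simp add: weight_def rev_map[symmetric] o_def)
  ultimately show "gauge (inv x) \<le> gauge x + e"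
    using gauge_le[of ?qs] ps(3) by simp
qed

lemma gauge_inv: "x \<in> carrier G \<Longrightarrow> gauge (inv x) = gauge x"
  using gauge_inv_le[of x] gauge_inv_le[of "inv x"] by simp

lemma ex_V_gauge_less:
  assumes "0 < e"
  shows "\<exists>n. \<forall>x\<in>V n. gauge x < e"
proof -
  obtain n where "(1/2::real) ^ n < e"
    using real_arch_pow_inv[OF assms, of "1/2"] by auto
  then show ?thesis
    using gauge_le_in_V by (meson le_less_trans)
qed

lemma gauge_eq_0_iff: "x \<in> carrier G \<Longrightarrow> gauge x = 0 \<longleftrightarrow> x \<in> (\<Inter>n. V n)"
proof
  assume x: "x \<in> carrier G" and "gauge x = 0"
  then show "x \<in> (\<Inter>n. V n)"
    using gauge_less_imp_in_V by simp
next
  assume x: "x \<in> carrier G" and "x \<in> (\<Inter>n. V n)"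
  then have "\<not> 0 < gauge x"
    using ex_V_gauge_less[of "gauge x"] by blast
  then show "gauge x = 0"
    using gauge_nonneg[OF x] by simp
qed

section \<open>The left-invariant pseudometric and its metric identification\<close>

text \<open>The default value 0 off the carrier makes nonnegativity and symmetry hold for all
  arguments, as \<open>Metric_space\<close> demands.\<close>

definition pdist :: "'a \<Rightarrow> 'a \<Rightarrow> real" where
  "pdist x y = (if x \<in> carrier G \<and> y \<in> carrier G then gauge (inv x \<otimes> y) else 0)"

lemma pdist_nonneg: "0 \<le> pdist x y"
  by (simp add: pdist_def gauge_nonneg)

lemma pdist_commute: "pdist x y = pdist y x"
  using gauge_inv[of "inv x \<otimes> y"] by (auto simp: pdist_def inv_mult_group)

lemma pdist_refl: "x \<in> carrier G \<Longrightarrow> pdist x x = 0"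
  using gauge_eq_0_iff[of \<one>] V_one by (simp add: pdist_def)

lemma pdist_triangle:
  assumes "x \<in> carrier G" "y \<in> carrier G" "z \<in> carrier G"
  shows "pdist x z \<le> pdist x y + pdist y z"
proof -
  have "inv x \<otimes> z = (inv x \<otimes> y) \<otimes> (inv y \<otimes> z)"
    using assms by (simp add: m_assoc mult_inv_cancel_left)
  then show ?thesis
    using gauge_mult[of "inv x \<otimes> y" "inv y \<otimes> z"] assms by (simp add: pdist_def)
qed

text \<open>The quotient by the relation \<open>pdist x y = 0\<close> is realized on a set of representatives.\<close>

definition repr :: "'a \<Rightarrow> 'a" where
  "repr x = (SOME y. y \<in> carrier G \<and> pdist x y = 0)"

lemma repr:
  assumes "x \<in> carrier G"
  shows "repr x \<in> carrier G" "pdist x (repr x) = 0"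
  using someI[of "\<lambda>y. y \<in> carrier G \<and> pdist x y = 0" x] assms pdist_refl
  by (auto simp: repr_def)

lemma pdist_repr:
  assumes "x \<in> carrier G" "y \<in> carrier G"
  shows "pdist (repr x) (repr y) = pdist x y"
proof (rule antisym)
  note r = repr[OF assms(1)] repr[OF assms(2)]
  show "pdist (repr x) (repr y) \<le> pdist x y"
    using pdist_triangle[of "repr x" x "repr y"] pdist_triangle[of x y "repr y"] r assms
      pdist_commute[of x "repr x"] by auto
  show "pdist x y \<le> pdist (repr x) (repr y)"
    using pdist_triangle[of x "repr x" y] pdist_triangle[of "repr x" "repr y" y] r assms
      pdist_commute[of y "repr y"] by auto
qed

lemma repr_eq_iff:
  assumes "x \<in> carrier G" "y \<in> carrier G"
  shows "repr x = repr y \<longleftrightarrow> pdist x y = 0"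
proof
  assume "repr x = repr y"
  then show "pdist x y = 0"
    using pdist_repr[OF assms] repr(1)[OF assms(1)] pdist_refl by simp
next
  assume 0: "pdist x y = 0"
  \<comment> \<open>Equivalent points define the same predicate under \<open>SOME\<close>, so the
    choices made by \<open>repr\<close> coincide.\<close>
  have "pdist x z = 0 \<longleftrightarrow> pdist y z = 0" if "z \<in> carrier G" for z
    using pdist_triangle[of x y z] pdist_triangle[of y x z] pdist_nonneg[of x z]
      pdist_nonneg[of y z] assms that 0 pdist_commute[of x y] by auto
  then show "repr x = repr y"
    unfolding repr_def by (intro arg_cong[of _ _ Eps]) auto
qed

sublocale quotient: Metric_space "repr ` carrier G" pdist
proof
  fix x y z assume "x \<in> repr ` carrier G" "y \<in> repr ` carrier G" "z \<in> repr ` carrier G"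
  then show "pdist x z \<le> pdist x y + pdist y z"
    using pdist_triangle repr(1) by auto
next
  fix x y assume "x \<in> repr ` carrier G" "y \<in> repr ` carrier G"
  then show "pdist x y = 0 \<longleftrightarrow> x = y"
    using pdist_repr repr_eq_iff by auto
qed (simp_all add: pdist_nonneg pdist_commute)

lemma continuous_map_repr: "continuous_map T quotient.mtopology repr"
  unfolding quotient.continuous_map_to_metric
proof (intro ballI allI impI)
  fix x and e :: real assume x: "x \<in> topspace T" and "0 < e"
  obtain n where n: "\<forall>y\<in>V n. gauge y < e"
    using ex_V_gauge_less[OF \<open>0 < e\<close>] by blast
  let ?U = "{y \<in> carrier G. inv x \<otimes> y \<in> V n}"
  have "openin T ?U"
    using x by (intro openin_translation V_open) (simp add: topspace_eq_carrier)
  moreover have "x \<in> ?U"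
    using x V_one by (simp add: topspace_eq_carrier)
  moreover have "repr y \<in> quotient.mball (repr x) e" if "y \<in> ?U" for y
    using that x n by (simp add: topspace_eq_carrier pdist_repr) (simp add: pdist_def)
  ultimately show "\<exists>U. openin T U \<and> x \<in> U \<and> (\<forall>y\<in>U. repr y \<in> quotient.mball (repr x) e)"
    by blast
qed

text \<open>The fibres are the left cosets of the intersection of the \<open>V n\<close>, which are
  translates of a compact set. For closedness, a neighbourhood of such a coset is translated back to
  the intersection, where it contains some \<open>V n\<close>; the ball of radius
  \<open>(1/2) ^ n\<close> then pulls back into the given neighbourhood.\<close>

lemma proper_map_repr:
  assumes compact: "compactin T (\<Inter>n. V n)"
    and base: "\<And>U. openin T U \<Longrightarrow> (\<Inter>n. V n) \<subseteq> U \<Longrightarrow> \<exists>n. V n \<subseteq> U"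
  shows "proper_map T quotient.mtopology repr"
proof -
  have coset: "{y \<in> topspace T. repr y = repr x} = (\<lambda>y. x \<otimes> y) ` (\<Inter>n. V n)" (is "?L = ?R")
    if x: "x \<in> carrier G" for x
  proof -
    have *: "y \<in> ?L \<longleftrightarrow> y \<in> carrier G \<and> inv x \<otimes> y \<in> (\<Inter>n. V n)" for y
      using repr_eq_iff[OF x, of y] gauge_eq_0_iff[of "inv x \<otimes> y"] x
      by (auto simp: topspace_eq_carrier pdist_def)
    show ?thesis
    proof (intro equalityI subsetI)
      fix y assume "y \<in> ?L"
      then have "y \<in> carrier G" "inv x \<otimes> y \<in> (\<Inter>n. V n)"
        unfolding * by auto
      moreover from this have "y = x \<otimes> (inv x \<otimes> y)"
        using x by (simp add: m_assoc[symmetric])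
      ultimately show "y \<in> ?R" by blast
    next
      fix y assume "y \<in> ?R"
      then obtain z where z: "z \<in> (\<Inter>n. V n)" "y = x \<otimes> z" by blast
      then have "z \<in> carrier G" using V_carrier by blast
      then show "y \<in> ?L"
        unfolding * using z x by (simp add: m_assoc[symmetric])
    qed
  qed
  show ?thesis
    unfolding proper_map_def closed_map_fibre_neighbourhood
  proof (intro conjI allI impI ballI; (elim conjE)?)
    show "repr \<in> topspace T \<rightarrow> topspace quotient.mtopology"
      by (simp add: topspace_eq_carrier)
  next
    fix y assume "y \<in> topspace quotient.mtopology"
    then obtain x where x: "x \<in> carrier G" "y = repr x" by auto
    then show "compactin T {x \<in> topspace T. repr x = y}"
      using coset image_compactin[OF compact continuous_map_translation] by simp
  next
    fix U y assume U: "openin T U" and "y \<in> topspace quotient.mtopology"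
      and sub: "{x \<in> topspace T. repr x = y} \<subseteq> U"
    then obtain x where x: "x \<in> carrier G" "y = repr x" by auto
    have "(\<Inter>n. V n) \<subseteq> {z \<in> carrier G. x \<otimes> z \<in> U}"
      using sub V_carrier unfolding x(2) coset[OF x(1)] by blast
    then obtain n where n: "V n \<subseteq> {z \<in> carrier G. x \<otimes> z \<in> U}"
      using base openin_translation[OF x(1) U] by meson
    have "z \<in> U" if "z \<in> carrier G" "repr z \<in> quotient.mball y ((1/2) ^ n)" for z
    proof -
      have "gauge (inv x \<otimes> z) < (1/2) ^ n"
        using that x pdist_repr[of x z] by (simp add: pdist_def[of x z])
      then have "inv x \<otimes> z \<in> V n"
        using that x by (intro gauge_less_imp_in_V) auto
      then have "x \<otimes> (inv x \<otimes> z) \<in> U"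
        using n by blast
      then show ?thesis
        using that x by (simp add: m_assoc[symmetric])
    qed
    then show "\<exists>W. openin quotient.mtopology W \<and> y \<in> W \<and> {x \<in> topspace T. repr x \<in> W} \<subseteq> U"
      using x by (intro exI[of _ "quotient.mball y ((1/2) ^ n)"])
        (auto simp: topspace_eq_carrier quotient.centre_in_mball_iff)
  qed
qed

text \<open>Points are closed, so every point outside \<open>K\<close> is missed by some
  \<open>V n\<close>; the intersection is thus a closed subset of the compact set \<open>K\<close>.
  For the base property, cover \<open>K\<close> by open sets \<open>W\<close> meeting some
  \<open>V n\<close> only inside \<open>U\<close>, pass to a finite subcover, and take an index
  large enough for all its members.\<close>

lemma base_at_Inter_V:
  assumes K: "compactin T K"
    and base: "\<And>U. openin T U \<Longrightarrow> K \<subseteq> U \<Longrightarrow> \<exists>n. V n \<subseteq> U"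
  shows "compactin T (\<Inter>n. V n)"
    and "openin T U \<Longrightarrow> (\<Inter>n. V n) \<subseteq> U \<Longrightarrow> \<exists>n. V n \<subseteq> U"
proof -
  have "(\<Inter>n. V n) \<subseteq> K"
  proof
    fix x assume x: "x \<in> (\<Inter>n. V n)"
    show "x \<in> K"
    proof (rule ccontr)
      assume "x \<notin> K"
      moreover have "closedin T {x}"
        using x V_carrier by (intro closedin_Hausdorff_sing_eq[THEN iffD2] Hausdorff)
          (auto simp: topspace_eq_carrier)
      ultimately obtain n where "V n \<subseteq> topspace T - {x}"
        using base[of "topspace T - {x}"] compactin_subset_topspace[OF K] by blast
      then show False using x by blast
    qed
  qed
  then show "compactin T (\<Inter>n. V n)"
    by (rule closed_compactin[OF K _ closedin_Inter_V])
  assume U: "openin T U" "(\<Inter>n. V n) \<subseteq> U"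
  \<comment> \<open>\<open>U\<close> itself belongs to \<open>\<W>\<close>, and so do the separating
    sets from \<open>V_separates\<close>, whose trace is empty.\<close>
  define \<W> where "\<W> = {W. openin T W \<and> (\<exists>n. W \<inter> V n \<subseteq> U)}"
  have "K \<subseteq> \<Union>\<W>"
  proof
    fix x assume "x \<in> K"
    then have x: "x \<in> carrier G"
      using compactin_subset_topspace[OF K] by (auto simp: topspace_eq_carrier)
    show "x \<in> \<Union>\<W>"
    proof (cases "x \<in> U")
      case True
      then show ?thesis using U(1) unfolding \<W>_def by blast
    next
      case False
      then obtain n where "x \<notin> V n" using U(2) by blast
      then obtain W where "openin T W" "x \<in> W" "W \<inter> V (Suc n) = {}"
        using V_separates[OF x] by metis
      then have "W \<in> \<W>" unfolding \<W>_def by blast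
      then show ?thesis using \<open>x \<in> W\<close> by blast
    qed
  qed
  moreover have "\<forall>W\<in>\<W>. openin T W"
    by (simp add: \<W>_def)
  ultimately obtain \<F> where \<F>: "finite \<F>" "\<F> \<subseteq> \<W>" "K \<subseteq> \<Union>\<F>"
    using K unfolding compactin_def by meson
  have "\<forall>W\<in>\<F>. \<exists>n. W \<inter> V n \<subseteq> U"
    using \<F>(2) by (auto simp: \<W>_def)
  then obtain m where m: "\<And>W. W \<in> \<F> \<Longrightarrow> W \<inter> V (m W) \<subseteq> U"
    by metis
  have "openin T (\<Union>\<F>)"
    using \<F>(2) by (auto simp: \<W>_def)
  then obtain n where n: "V n \<subseteq> \<Union>\<F>"
    using base \<F>(3) by blast
  \<comment> \<open>Past \<open>n\<close> the chain lies inside the finite cover; past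
    \<open>m W\<close> its trace on \<open>W\<close> lies in \<open>U\<close>.\<close>
  define k where "k = Max (insert n (m ` \<F>))"
  have "V k \<subseteq> U"
  proof
    fix x assume x: "x \<in> V k"
    have "n \<le> k" using \<F>(1) by (simp add: k_def)
    then obtain W where W: "W \<in> \<F>" "x \<in> W"
      using n x V_mono by blast
    have "m W \<le> k" using \<F>(1) W(1) by (simp add: k_def)
    then show "x \<in> U" using m[OF W(1)] W(2) x V_mono by blast
  qed
  then show "\<exists>n. V n \<subseteq> U" by blast
qed

end

section \<open>Proper maps from feathered groups to metrizable spaces\<close>

text \<open>Translate the compact set so that it contains the unit, enumerate its countable base as
  \<open>B n\<close>, and choose the chain recursively with \<open>V (Suc n)\<close> inside
  \<open>B n\<close>. Every neighbourhood of the compact set then contains some \<open>V n\<close>,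
  so \<open>base_at_Inter_V\<close> applies.\<close>

lemma (in topological_group) feathered_imp_nbhd_chain:
  assumes "feathered T"
  obtains V where "nbhd_chain G T V" "compactin T (\<Inter>n. V n)"
    "\<And>U. openin T U \<Longrightarrow> (\<Inter>n. V n) \<subseteq> U \<Longrightarrow> \<exists>n. V n \<subseteq> U"
proof -
  obtain K0 a where K0: "compactin T K0" "countable_character_in T K0" "a \<in> K0"
    using assms by (auto simp: feathered_def)
  then have a: "a \<in> carrier G"
    using compactin_subset_topspace topspace_eq_carrier by blast
  define K where "K = (\<lambda>x. inv a \<otimes> x) ` K0"
  have K: "compactin T K" "countable_character_in T K"
    using countable_character_translate[of "inv a" K0] K0 a by (auto simp: K_def)
  have "\<one> \<in> K"
    using K0(3) a unfolding K_def by (metis image_eqI l_inv)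
  obtain \<B> where \<B>: "countable \<B>" "\<And>V. V \<in> \<B> \<Longrightarrow> openin T V \<and> K \<subseteq> V"
    "\<And>U. openin T U \<Longrightarrow> K \<subseteq> U \<Longrightarrow> \<exists>V\<in>\<B>. V \<subseteq> U"
    using K(2) unfolding countable_character_in_def by metis
  have "\<B> \<noteq> {}"
    using \<B>(3)[of "topspace T"] compactin_subset_topspace[OF K(1)] by blast
  define B where "B = from_nat_into \<B>"
  have B: "openin T (B n)" "\<one> \<in> B n" for n
    using \<B>(2)[OF from_nat_into[OF \<open>\<B> \<noteq> {}\<close>]] \<open>\<one> \<in> K\<close> by (auto simp: B_def)
  \<comment> \<open>\<open>P\<close> is the invariant of a single stage, its last clause fixing the
    start of the recursion; \<open>Q\<close> relates stage \<open>n\<close> to stage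
    \<open>Suc n\<close>.\<close>
  define P where "P n V \<longleftrightarrow> openin T V \<and> \<one> \<in> V \<and> (\<forall>x\<in>V. inv x \<in> V) \<and>
    (n = 0 \<longrightarrow> V = carrier G)" for n :: nat and V
  define Q where "Q n V V' \<longleftrightarrow> V' \<subseteq> B n \<and> (\<forall>x\<in>V'. \<forall>y\<in>V'. \<forall>z\<in>V'. x \<otimes> y \<otimes> z \<in> V)"
    for n and V V' :: "'a set"
  have "\<exists>V. \<forall>n. P n (V n) \<and> Q n (V n) (V (Suc n))"
  proof (rule dependent_nat_choice)
    have "P 0 (carrier G)"
      using openin_topspace[of T] by (simp add: P_def topspace_eq_carrier)
    then show "\<exists>V. P 0 V" by blast
  next
    fix V n assume "P n V"
    then have "openin T (V \<inter> B n)" "\<one> \<in> V \<inter> B n"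
      using B by (auto simp: P_def)
    from symmetric_cube_nbhd[OF this] obtain W where W: "openin T W" "\<one> \<in> W"
      "\<forall>x\<in>W. inv x \<in> W" "\<forall>x\<in>W. \<forall>y\<in>W. \<forall>z\<in>W. x \<otimes> y \<otimes> z \<in> V \<inter> B n"
      by blast
    have "x \<in> B n" if "x \<in> W" for x
    proof -
      have "x \<in> carrier G"
        using that openin_subset[OF W(1)] by (auto simp: topspace_eq_carrier)
      moreover have "x \<otimes> \<one> \<otimes> \<one> \<in> V \<inter> B n"
        using W(2,4) that by blast
      ultimately show ?thesis by simp
    qed
    then show "\<exists>W. P (Suc n) W \<and> Q n V W"
      using W by (intro exI[of _ W]) (auto simp: P_def Q_def)
  qed
  then obtain V where V: "\<And>n. P n (V n)" "\<And>n. Q n (V n) (V (Suc n))"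
    by blast
  interpret nbhd_chain G T V
    by unfold_locales (use V in \<open>auto simp: P_def Q_def\<close>)
  have base: "\<exists>n. V n \<subseteq> U" if "openin T U" "K \<subseteq> U" for U
  proof -
    obtain W where W: "W \<in> \<B>" "W \<subseteq> U"
      using \<B>(3) \<open>openin T U\<close> \<open>K \<subseteq> U\<close> by blast
    obtain n where "B n = W"
      using from_nat_into_surj[OF \<B>(1) W(1)] unfolding B_def by blast
    then have "B n \<subseteq> U"
      using W(2) by simp
    then have "V (Suc n) \<subseteq> U"
      using V(2)[of n] unfolding Q_def by blast
    then show ?thesis by blast
  qed
  show thesis
    using that[OF nbhd_chain_axioms] base_at_Inter_V[OF K(1) base] by blast
qed

lemma (in topological_group) feathered_imp_proper_map_metrizable:
  assumes "feathered T"
  obtains X :: "'a topology" and p where "metrizable_space X" "continuous_map T X p"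
    "proper_map T X p"
proof -
  obtain V where V: "nbhd_chain G T V" "compactin T (\<Inter>n. V n)"
    "\<And>U. openin T U \<Longrightarrow> (\<Inter>n. V n) \<subseteq> U \<Longrightarrow> \<exists>n. V n \<subseteq> U"
    using feathered_imp_nbhd_chain[OF assms] by metis
  interpret nbhd_chain G T V by (rule V(1))
  show thesis
    using that[OF quotient.metrizable_space_mtopology continuous_map_repr]
      proper_map_repr[OF V(2,3)] by blast
qed

section \<open>Fibres of proper maps and the two implications\<close>

lemma proper_map_cong:
  assumes "\<And>x. x \<in> topspace X \<Longrightarrow> f x = g x"
  shows "proper_map X Y f \<longleftrightarrow> proper_map X Y g"
proof -
  have "f ` C = g ` C" if "closedin X C" for C
    using assms closedin_subset[OF that] by (intro image_cong) auto
  moreover have "{x \<in> topspace X. f x = y} = {x \<in> topspace X. g x = y}" for y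
    using assms by auto
  ultimately show ?thesis
    by (simp add: proper_map_def closed_map_def)
qed

text \<open>The preimages of a countable local base at \<open>y\<close> work: since \<open>p\<close>
  is closed, each neighbourhood of the fibre contains the preimage of a neighbourhood of
  \<open>y\<close>.\<close>

lemma proper_map_fibre_countable_character:
  assumes p: "proper_map X Y p" "continuous_map X Y p" and Y: "first_countable Y" "y \<in> topspace Y"
  shows "countable_character_in X {x \<in> topspace X. p x = y}"
proof -
  obtain \<B> where \<B>: "countable \<B>" "\<And>V. V \<in> \<B> \<Longrightarrow> openin Y V"
    "\<And>U. openin Y U \<Longrightarrow> y \<in> U \<Longrightarrow> \<exists>V\<in>\<B>. y \<in> V \<and> V \<subseteq> U"
    using Y unfolding first_countable_def by metis
  let ?pre = "\<lambda>V. {x \<in> topspace X. p x \<in> V}"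
  show ?thesis
    unfolding countable_character_in_def
  proof (intro exI[of _ "?pre ` {V \<in> \<B>. y \<in> V}"] conjI ballI allI impI; (elim conjE)?)
    show "countable (?pre ` {V \<in> \<B>. y \<in> V})"
      using \<B>(1) by (intro countable_image countable_Collect)
  next
    fix W assume "W \<in> ?pre ` {V \<in> \<B>. y \<in> V}"
    then show "openin X W" "{x \<in> topspace X. p x = y} \<subseteq> W"
      using \<B>(2) openin_continuous_map_preimage[OF p(2)] by auto
  next
    fix U assume "openin X U" "{x \<in> topspace X. p x = y} \<subseteq> U"
    moreover have "closed_map X Y p"
      using p(1) by (simp add: proper_map_def)
    ultimately obtain W where W: "openin Y W" "y \<in> W" "?pre W \<subseteq> U"
      using Y(2) unfolding closed_map_fibre_neighbourhood by meson
    then obtain V where "V \<in> \<B>" "y \<in> V" "V \<subseteq> W"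
      using \<B>(3) by blast
    then have "?pre V \<subseteq> U" "?pre V \<in> ?pre ` {V \<in> \<B>. y \<in> V}"
      using W(3) by auto
    then show "\<exists>V\<in>?pre ` {V \<in> \<B>. y \<in> V}. V \<subseteq> U"
      by (rule bexI)
  qed
qed

lemma PSM_factorizable_imp_feathered:
  assumes "topological_group G T" "PSM_factorizable G T"
  shows "feathered T"
proof -
  interpret topological_group G T by fact
  \<comment> \<open>Factorizing the constant map to a point supplies a perfect homomorphism onto a
    metrizable group; its kernel \<open>?K\<close> is the required compact set.\<close>
  let ?M = "discrete_topology {()}"
  have M: "metrizable_space ?M" "continuous_map T ?M (\<lambda>_. ())"
    by (auto simp: metrizable_space_discrete_topology)
  from PSM_factorizableD[OF assms(2) topspace_eq_carrier M]
  obtain H :: "'a set monoid" and S \<pi> where H: "topological_group H S" "metrizable_space S"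
    "perfect_hom G T H S \<pi>"
    by (elim exE conjE) (rule that; assumption)
  have \<pi>: "proper_map T S \<pi>" "continuous_map T S \<pi>"
    using H(3) by (auto simp: perfect_hom_def perfect_map_def)
  have y: "\<pi> \<one>\<^bsub>G\<^esub> \<in> topspace S"
    using \<pi>(2) by (simp add: continuous_map_def Pi_iff topspace_eq_carrier)
  let ?K = "{x \<in> topspace T. \<pi> x = \<pi> \<one>\<^bsub>G\<^esub>}"
  have "?K \<noteq> {}"
    using topspace_eq_carrier by blast
  moreover have "compactin T ?K"
    using \<pi>(1) y by (simp add: proper_map_def)
  moreover have "countable_character_in T ?K"
    by (rule proper_map_fibre_countable_character
        [OF \<pi> metrizable_imp_first_countable[OF H(2)] y])
  ultimately show ?thesis
    unfolding feathered_def by (intro exI conjI)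
qed

lemma PSM_factorizable_imp_SM_factorizable:
  assumes "topological_group G T" "PSM_factorizable G T"
  shows "SM_factorizable G T"
proof (rule SM_factorizableI)
  show T: "topspace T = carrier G"
    by (rule topological_group.topspace_eq_carrier[OF assms(1)])
  fix M :: "'a set topology" and f
  assume M: "metrizable_space M" "continuous_map T M f"
  from PSM_factorizableD[OF assms(2) T M]
  obtain H :: "'a set monoid" and S \<pi> g where H: "topological_group H S"
    "metrizable_space S" "perfect_hom G T H S \<pi>"
    and g: "continuous_map S M g" "\<forall>x\<in>carrier G. f x = g (\<pi> x)"
    by (elim exE conjE) (rule that; assumption)
  have "continuous_hom_onto G T H S \<pi>"
    using H(3) T topological_group.topspace_eq_carrier[OF H(1)]
    by (simp add: perfect_hom_def perfect_map_def continuous_hom_onto_def)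
  then show "\<exists>(H :: 'a set monoid) S \<pi> g.
      topological_group H S \<and> metrizable_space S \<and> continuous_hom_onto G T H S \<pi> \<and>
      continuous_map S M g \<and> (\<forall>x\<in>carrier G. f x = g (\<pi> x))"
    using H(1,2) g by (intro exI conjI)
qed

lemma feathered_SM_factorizable_imp_PSM_factorizable:
  assumes "topological_group G T" "feathered T" "SM_factorizable G T"
  shows "PSM_factorizable G T"
proof (rule PSM_factorizableI)
  interpret topological_group G T by fact
  show T: "topspace T = carrier G" by (rule topspace_eq_carrier)
  fix M :: "'a set topology" and f
  assume M: "metrizable_space M" "continuous_map T M f"
  obtain X :: "'a topology" and p where X: "metrizable_space X" "continuous_map T X p"
    "proper_map T X p"
    using feathered_imp_proper_map_metrizable[OF assms(2)] by metis
  have m: "metrizable_space (prod_topology M X)"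
    using M(1) X(1) by (simp add: metrizable_space_prod_topology)
  \<comment> \<open>Pairing forces one homomorphism to factorize both \<open>f\<close> and the
    proper map \<open>p\<close>.\<close>
  have c: "continuous_map T (prod_topology M X) (\<lambda>x. (f x, p x))"
    using M(2) X(2) by (rule continuous_map_pairedI)
  from SM_factorizableD[OF assms(3) T m c]
  obtain H :: "'a set monoid" and S \<pi> g where H: "topological_group H S"
    "metrizable_space S" "continuous_hom_onto G T H S \<pi>"
    and g: "continuous_map S (prod_topology M X) g" "\<forall>x\<in>carrier G. (f x, p x) = g (\<pi> x)"
    by (elim exE conjE) (rule that; assumption)
  have \<pi>: "\<pi> \<in> hom G H" "continuous_map T S \<pi>" "\<pi> ` carrier G = carrier H"
    using H(3) by (auto simp: continuous_hom_onto_def)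
  have "proper_map T X ((snd \<circ> g) \<circ> \<pi>)"
  proof (rule iffD1[OF proper_map_cong X(3)])
    fix x assume "x \<in> topspace T"
    then show "p x = ((snd \<circ> g) \<circ> \<pi>) x"
      using g(2) T by (metis comp_apply snd_conv)
  qed
  \<comment> \<open>Properness cancels on the right: \<open>(snd \<circ> g) \<circ> \<pi>\<close> is
    proper, both factors are continuous, and \<open>S\<close> is Hausdorff.\<close>
  then have "proper_map T S \<pi>"
    using proper_map_from_composition_right[OF metrizable_imp_Hausdorff_space[OF H(2)] _ \<pi>(2)]
      continuous_map_compose[OF g(1) continuous_map_snd] by blast
  then have "perfect_hom G T H S \<pi>"
    using \<pi> T topological_group.topspace_eq_carrier[OF H(1)]
    by (simp add: perfect_hom_def perfect_map_def)
  moreover have "continuous_map S M (fst \<circ> g)"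
    by (rule continuous_map_compose[OF g(1) continuous_map_fst])
  moreover have "\<forall>x\<in>carrier G. f x = (fst \<circ> g) (\<pi> x)"
  proof
    fix x assume "x \<in> carrier G"
    then have "g (\<pi> x) = (f x, p x)"
      using g(2) by simp
    then show "f x = (fst \<circ> g) (\<pi> x)"
      by simp
  qed
  ultimately show "\<exists>(H :: 'a set monoid) S \<pi> g.
      topological_group H S \<and> metrizable_space S \<and> perfect_hom G T H S \<pi> \<and>
      continuous_map S M g \<and> (\<forall>x\<in>carrier G. f x = g (\<pi> x))"
    using H(1,2) by (intro exI conjI)
qed

theorem theorem6p5:
  fixes G :: "('a, 'b) monoid_scheme" and T :: "'a topology"
  assumes "topological_group G T"
  shows "PSM_factorizable G T \<longleftrightarrow> feathered T \<and> SM_factorizable G T"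
  using PSM_factorizable_imp_feathered[OF assms] PSM_factorizable_imp_SM_factorizable[OF assms]
    feathered_SM_factorizable_imp_PSM_factorizable[OF assms] by blast

end
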